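(* Let $n\ge1$. There exist generators $\Gamma_1,\dots,\Gamma_{2n}$ of $Cl(2n)$, acting on the Hilbert space $(\mathbb{C}^2)^{\otimes n}$, an index $i\in\{1,\dots,2n\}$, and a state $|\psi\rangle$ such that $|\psi\rangle$ belongs to the type-I class $\mathcal{C}_i$ determined by the operators $O_k=\Gamma_k$, $k=1,\dots,2n$; that is, there is a constant $c_i\neq0$ with $$\langle\psi|\Gamma_k|\psi\rangle=\delta_{ik}\,c_i\qquad\text{for all }k=1,\dots,2n.$$
   Context: A state is a unit vector of a Hilbert space. Given a Hilbert space $\mathcal{H}$ and linear operators $\{O_k\}_{k=1}^{2n}$ on $\mathcal{H}$, the class of type I, $\mathcal{C}_i$, is the set of states $|\psi\rangle\in\mathcal{H}$ for which there exists a nonzero constant $c_i$ with $\langle\psi|O_k|\psi\rangle=\delta_{ik}c_i$ for all $k=1,\dots,2n$ ($\delta_{ik}$ the Kronecker delta). The generators of the Clifford algebra $Cl(2n)$ are represented on $(\mathbb{C}^2)^{\otimes n}$ by, for $1\le j\le n$, $\Gamma_j=\sigma_1^{\otimes (j-1)}\otimes\sigma_2\otimes I^{\otimes (n-j)}$ and $\Gamma_{n+j}=\sigma_1^{\otimes (j-1)}\otimes\sigma_3\otimes I^{\otimes (n-j)}$, where $\sigma_1=\begin{pmatrix}0&1\\1&0\end{pmatrix}$, $\sigma_2=\begin{pmatrix}0&-i\\i&0\end{pmatrix}$, $\sigma_3=\begin{pmatrix}1&0\\0&-1\end{pmatrix}$ and $I$ is the $2\times2$ identity. They are Hermitian and satisfy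 $\Gamma_a\Gamma_b+\Gamma_b\Gamma_a=2\delta_{ab}I$. *)

theory Defs
  imports "Jordan_Normal_Form.Schur_Decomposition"
begin

text \<open>
  \<open>(\<complex>\<^sup>2)\<^sup>\<otimes>\<^sup>n\<close> is taken to be \<open>\<complex>\<^sup>N\<close> with \<open>N = 2 ^ n\<close>, i.e. coordinates with respect to the
  orthonormal product basis, with the standard Hermitian inner product
  \<open>\<langle>\<phi>|\<psi>\<rangle> = \<psi> \<bullet>c \<phi>\<close> (the second argument of \<open>\<bullet>c\<close> is the conjugated one).
  Families of operators are indexed by \<open>1, \<dots>, m\<close>; values at other indices are irrelevant.
\<close>

definition states :: "nat \<Rightarrow> complex vec set" where
  "states N = {\<psi> \<in> carrier_vec N. \<psi> \<bullet>c \<psi> = 1}"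

definition expectation :: "complex mat \<Rightarrow> complex vec \<Rightarrow> complex" where
  "expectation A \<psi> = (A *\<^sub>v \<psi>) \<bullet>c \<psi>"

definition type_I_class :: "nat \<Rightarrow> nat \<Rightarrow> (nat \<Rightarrow> complex mat) \<Rightarrow> nat \<Rightarrow> complex vec set" where
  "type_I_class N m Op i =
     {\<psi> \<in> states N. \<exists>c. c \<noteq> 0 \<and>
        (\<forall>k\<in>{1..m}. expectation (Op k) \<psi> = (if i = k then 1 else 0) * c)}"

text \<open>
  Hermitian generators of \<open>Cl(2n)\<close> acting on \<open>(\<complex>\<^sup>2)\<^sup>\<otimes>\<^sup>n\<close>. Since the complex Clifford algebra on
  an even number of generators is simple, the relations already make the representation faithful.
\<close>

definition clifford_generators :: "nat \<Rightarrow> (nat \<Rightarrow> complex mat) \<Rightarrow> bool" where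
  "clifford_generators n \<Gamma> \<longleftrightarrow>
     (\<forall>a\<in>{1..2 * n}. \<Gamma> a \<in> carrier_mat (2 ^ n) (2 ^ n) \<and> mat_adjoint (\<Gamma> a) = \<Gamma> a) \<and>
     (\<forall>a\<in>{1..2 * n}. \<forall>b\<in>{1..2 * n}.
        \<Gamma> a * \<Gamma> b + \<Gamma> b * \<Gamma> a = (2 * (if a = b then 1 else 0)) \<cdot>\<^sub>m 1\<^sub>m (2 ^ n))"

end

(* If A v = v with A Hermitian and AB + BA = 0, then 0 = <v|(AB + BA)v> = 2 <v|Bv>; so any
   eigenvector of one Hermitian generator for the eigenvalue 1 has vanishing expectation in all the
   others. The generators are built recursively as \<sigma>_1 \<otimes> \<Gamma>_a, \<sigma>_2 \<otimes> I, \<sigma>_3 \<otimes> I; the last one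
   fixes the first basis vector. *)

theory Submission
  imports Defs
begin

text \<open>The Kronecker product of the \<open>2 \<times> 2\<close> matrix with rows \<open>(p, q)\<close>, \<open>(r, s)\<close> with \<open>X\<close>.\<close>
definition tensor2 :: "'a::semiring_0 \<Rightarrow> 'a \<Rightarrow> 'a \<Rightarrow> 'a \<Rightarrow> 'a mat \<Rightarrow> 'a mat" where
  "tensor2 p q r s X = four_block_mat (p \<cdot>\<^sub>m X) (q \<cdot>\<^sub>m X) (r \<cdot>\<^sub>m X) (s \<cdot>\<^sub>m X)"

lemma tensor2_carrier_mat [simp]:
  "X \<in> carrier_mat m n \<Longrightarrow> tensor2 p q r s X \<in> carrier_mat (m + m) (n + n)"
  by (simp add: tensor2_def)

lemma mat_adjoint_tensor2:
  assumes "X \<in> carrier_mat m n"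
  shows "mat_adjoint (tensor2 p q r s X)
    = tensor2 (conjugate p) (conjugate r) (conjugate q) (conjugate s) (mat_adjoint X)"
  using assms
  by (intro eq_matI) (auto simp: tensor2_def mat_adjoint_def mat_of_rows_def conjugate_dist_mul)

text \<open>The mixed-product rule for Kronecker products. Each block of the product is a sum of two
  multiples of \<open>X * Y\<close>, since commutativity of the ring lets the scalars move past the
  matrix entries.\<close>

lemma tensor2_mult:
  fixes X Y :: "'a::comm_ring mat"
  assumes X: "X \<in> carrier_mat m n" and Y: "Y \<in> carrier_mat n k"
  shows "tensor2 p q r s X * tensor2 p' q' r' s' Y
    = tensor2 (p * p' + q * r') (p * q' + q * s') (r * p' + s * r') (r * q' + s * s') (X * Y)"
proof -
  have XY: "(a \<cdot>\<^sub>m X) * (b \<cdot>\<^sub>m Y) + (c \<cdot>\<^sub>m X) * (d \<cdot>\<^sub>m Y) = (a * b + c * d) \<cdot>\<^sub>m (X * Y)"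
    for a b c d
    using X Y
    by (simp add: mult_smult_distrib[of _ m n _ k] mult_smult_assoc_mat[of _ m n _ k])
      (auto intro!: eq_matI simp: distrib_right mult_ac)
  show ?thesis
    unfolding tensor2_def using X Y
    by (subst mult_four_block_mat[of _ m n _ n _ m _ _ k _ k]) (auto simp: XY)
qed

lemma tensor2_add_right:
  assumes "X \<in> carrier_mat m n" "Y \<in> carrier_mat m n"
  shows "tensor2 p q r s X + tensor2 p q r s Y = tensor2 p q r s (X + Y)"
  using assms by (intro eq_matI) (auto simp: tensor2_def distrib_left)

lemma tensor2_add_left:
  "tensor2 p q r s X + tensor2 p' q' r' s' X = tensor2 (p + p') (q + q') (r + r') (s + s') X"
  by (intro eq_matI) (auto simp: tensor2_def distrib_right)

lemma tensor2_one:
  fixes c d :: "'a::comm_semiring_1"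
  shows "tensor2 c 0 0 c (d \<cdot>\<^sub>m 1\<^sub>m n) = (c * d) \<cdot>\<^sub>m 1\<^sub>m (n + n)"
  by (intro eq_matI) (auto simp: tensor2_def)

lemma tensor2_0:
  assumes "X \<in> carrier_mat m n"
  shows "tensor2 0 0 0 0 X = 0\<^sub>m (m + m) (n + n)"
  using assms by (intro eq_matI) (auto simp: tensor2_def)

lemma mat_adjoint_one: "mat_adjoint (1\<^sub>m n :: complex mat) = 1\<^sub>m n"
  by (intro eq_matI) (auto simp: mat_adjoint_def mat_of_rows_def)

text \<open>Both sides are the same double sum over the entries of \<open>A\<close>, taken in
  opposite orders. Used to move a Hermitian operator from one side of the inner product to the
  other.\<close>

lemma cscalar_mat_adjoint:
  assumes "A \<in> carrier_mat m n" "u \<in> carrier_vec m" "v \<in> carrier_vec n"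
  shows "(A *\<^sub>v v) \<bullet>c u = v \<bullet>c (mat_adjoint A *\<^sub>v u)"
proof -
  have "(A *\<^sub>v v) \<bullet>c u = (\<Sum>i<m. \<Sum>j<n. A $$ (i, j) * v $ j * conjugate (u $ i))"
    using assms by (simp add: scalar_prod_def sum_distrib_right lessThan_atLeast0)
  also have "\<dots> = (\<Sum>j<n. \<Sum>i<m. A $$ (i, j) * v $ j * conjugate (u $ i))"
    by (rule sum.swap)
  also have "\<dots> = v \<bullet>c (mat_adjoint A *\<^sub>v u)"
    using assms
    by (simp add: scalar_prod_def mat_adjoint_def mat_of_rows_def sum_conjugate
      conjugate_dist_mul sum_distrib_left lessThan_atLeast0 mult_ac)
  finally show ?thesis .
qed

lemma expectation_anticommuting_eq_0:
  assumes A: "A \<in> carrier_mat N N" "mat_adjoint A = A"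
    and B: "B \<in> carrier_mat N N"
    and AB: "A * B + B * A = 0\<^sub>m N N"
    and v: "v \<in> carrier_vec N" "A *\<^sub>v v = v"
  shows "expectation B v = 0"
proof -
  have Bv: "B *\<^sub>v v \<in> carrier_vec N"
    using B v by simp
  \<comment> \<open>Hermiticity moves \<open>A\<close> onto the right-hand \<open>v\<close>, which
    it fixes, so \<open>A\<close> disappears.\<close>
  have fst: "(A *\<^sub>v (B *\<^sub>v v)) \<bullet>c v = expectation B v"
    using cscalar_mat_adjoint[OF A(1) v(1) Bv] A(2) v(2) by (simp add: expectation_def)
  have "(A * B + B * A) *\<^sub>v v = A *\<^sub>v (B *\<^sub>v v) + B *\<^sub>v v"
    using A(1) B v by (simp add: add_mult_distrib_mat_vec[of _ N N])
  moreover have "0\<^sub>m N N *\<^sub>v v = 0\<^sub>v N"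
    using v(1) by (intro eq_vecI) auto
  ultimately have sum_0: "A *\<^sub>v (B *\<^sub>v v) + B *\<^sub>v v = 0\<^sub>v N"
    using AB by simp
  have "(A *\<^sub>v (B *\<^sub>v v) + B *\<^sub>v v) \<bullet>c v = (A *\<^sub>v (B *\<^sub>v v)) \<bullet>c v + (B *\<^sub>v v) \<bullet>c v"
    using A(1) B v by (intro add_scalar_prod_distrib[of _ N]) auto
  then show ?thesis
    unfolding sum_0 using v(1) fst by (simp add: expectation_def)
qed

text \<open>The new qubit is the leftmost tensor factor, so the three cases are the block forms of
  \<sigma>_1, \<sigma>_2 and \<sigma>_3 there. Iterated from the empty family, this gives the usual
  Pauli strings \<sigma>_1 \<otimes> ... \<otimes> \<sigma>_1 \<otimes> \<sigma>_2 \<otimes> I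
  \<otimes> ... \<otimes> I, and those with \<sigma>_3 for \<sigma>_2, ordered so that the two
  newest come last.\<close>

definition double_generators :: "nat \<Rightarrow> (nat \<Rightarrow> complex mat) \<Rightarrow> nat \<Rightarrow> complex mat" where
  "double_generators n \<Gamma> a =
    (if a \<le> 2 * n then tensor2 0 1 1 0 (\<Gamma> a)
     else if a = 2 * n + 1 then tensor2 0 (- \<i>) \<i> 0 (1\<^sub>m (2 ^ n))
     else tensor2 1 0 0 (- 1) (1\<^sub>m (2 ^ n)))"

text \<open>Adjoints act factorwise, so Hermiticity is inherited from the Pauli matrices and the old
  generators. For two old generators \<sigma>_1 squares to the identity and the old relation
  survives in the right factor; in all other pairs the relation comes from the Pauli matrices on the
  left.\<close>

lemma clifford_generators_double:
  assumes "clifford_generators n \<Gamma>"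
  shows "clifford_generators (Suc n) (double_generators n \<Gamma>)"
proof -
  define N :: nat where "N = 2 ^ n"
  have N2: "2 ^ Suc n = N + N"
    by (simp add: N_def)
  let ?D = "double_generators n \<Gamma>"
  have old: "?D a = tensor2 0 1 1 0 (\<Gamma> a)" if "a \<in> {1..2 * n}" for a
    using that by (simp add: double_generators_def)
  have new: "?D (2 * n + 1) = tensor2 0 (- \<i>) \<i> 0 (1\<^sub>m N)"
    "?D (2 * n + 2) = tensor2 1 0 0 (- 1) (1\<^sub>m N)"
    by (simp_all add: double_generators_def N_def)
  have G: "\<Gamma> a \<in> carrier_mat N N" "mat_adjoint (\<Gamma> a) = \<Gamma> a" if "a \<in> {1..2 * n}" for a
    using assms that by (auto simp: clifford_generators_def N_def)
  have GG: "\<Gamma> a * \<Gamma> b + \<Gamma> b * \<Gamma> a = (2 * (if a = b then 1 else 0)) \<cdot>\<^sub>m 1\<^sub>m N"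
    if "a \<in> {1..2 * n}" "b \<in> {1..2 * n}" for a b
    using assms that by (auto simp: clifford_generators_def N_def)
  have cases: "a \<in> {1..2 * n} \<or> a = 2 * n + 1 \<or> a = 2 * n + 2" if "a \<in> {1..2 * Suc n}" for a
    using that by auto
  have herm: "?D a \<in> carrier_mat (N + N) (N + N) \<and> mat_adjoint (?D a) = ?D a"
    if "a \<in> {1..2 * Suc n}" for a
    using cases[OF that]
    by (elim disjE) (simp_all only: old new,
      simp_all add: G mat_adjoint_tensor2[of _ N N] mat_adjoint_one)
  have two: "tensor2 2 0 0 2 (1\<^sub>m N) = (2 \<cdot>\<^sub>m 1\<^sub>m (N + N) :: complex mat)"
    by (intro eq_matI) (auto simp: tensor2_def)
  have zero: "0 \<cdot>\<^sub>m 1\<^sub>m (N + N) = (0\<^sub>m (N + N) (N + N) :: complex mat)"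
    by auto
  have old_old: "?D a * ?D b + ?D b * ?D a = (2 * (if a = b then 1 else 0)) \<cdot>\<^sub>m 1\<^sub>m (N + N)"
    if "a \<in> {1..2 * n}" "b \<in> {1..2 * n}" for a b
  proof -
    have "?D a * ?D b + ?D b * ?D a = tensor2 1 0 0 1 (\<Gamma> a * \<Gamma> b) + tensor2 1 0 0 1 (\<Gamma> b * \<Gamma> a)"
      using G[OF that(1)] G[OF that(2)]
      by (simp add: old[OF that(1)] old[OF that(2)] tensor2_mult[of _ N N _ N])
    also have "\<dots> = tensor2 1 0 0 1 (\<Gamma> a * \<Gamma> b + \<Gamma> b * \<Gamma> a)"
      using G[OF that(1)] G[OF that(2)] by (intro tensor2_add_right[of _ N N]) auto
    finally show ?thesis
      by (simp only: GG[OF that] tensor2_one mult_1)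
  qed
  \<comment> \<open>The right factors \<open>\<Gamma> a\<close> and the identity commute, so the
    anticommutator of \<sigma>_1 with \<sigma>_2 or \<sigma>_3, which is zero, can be collected on
    the left.\<close>
  have old_new: "?D a * ?D b + ?D b * ?D a = 0 \<cdot>\<^sub>m 1\<^sub>m (N + N)"
    if "a \<in> {1..2 * n}" "b = 2 * n + 1 \<or> b = 2 * n + 2" for a b
    using that(2) G[OF that(1)]
    by (elim disjE) (simp_all only: old[OF that(1)] new,
      simp_all add: tensor2_mult[of _ N N _ N] tensor2_add_left tensor2_0[of _ N N] zero)
  have new_new: "?D a * ?D b + ?D b * ?D a = (2 * (if a = b then 1 else 0)) \<cdot>\<^sub>m 1\<^sub>m (N + N)"
    if "a = 2 * n + 1 \<or> a = 2 * n + 2" "b = 2 * n + 1 \<or> b = 2 * n + 2" for a b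
    using that
    by (elim disjE) (simp_all only: new,
      simp_all add: tensor2_mult[of _ N N _ N] tensor2_add_left tensor2_0[of _ N N] zero two)
  \<comment> \<open>Symmetry of the anticommutator reduces the pairs (new, old) to the pairs (old,
    new).\<close>
  have comm: "?D a * ?D b + ?D b * ?D a = ?D b * ?D a + ?D a * ?D b"
    if "a \<in> {1..2 * Suc n}" "b \<in> {1..2 * Suc n}" for a b
    using herm[OF that(1)] herm[OF that(2)]
    by (intro comm_add_mat[of _ "N + N" "N + N"] mult_carrier_mat[of _ _ "N + N"]) auto
  have anti: "?D a * ?D b + ?D b * ?D a = (2 * (if a = b then 1 else 0)) \<cdot>\<^sub>m 1\<^sub>m (N + N)"
    if ab: "a \<in> {1..2 * Suc n}" "b \<in> {1..2 * Suc n}" for a b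
  proof -
    consider "a \<in> {1..2 * n}" "b \<in> {1..2 * n}"
      | "a \<in> {1..2 * n}" "b = 2 * n + 1 \<or> b = 2 * n + 2"
      | "a = 2 * n + 1 \<or> a = 2 * n + 2" "b \<in> {1..2 * n}"
      | "a = 2 * n + 1 \<or> a = 2 * n + 2" "b = 2 * n + 1 \<or> b = 2 * n + 2"
      using cases ab by blast
    then show ?thesis
    proof cases
      case 1
      then show ?thesis by (rule old_old)
    next
      case 2
      moreover have "a \<noteq> b" using 2 by auto
      ultimately show ?thesis using old_new by simp
    next
      case 3
      moreover have "a \<noteq> b" using 3 by auto
      ultimately show ?thesis using old_new comm[OF ab] by simp
    next
      case 4
      then show ?thesis by (rule new_new)
    qed
  qed
  show ?thesis
    using herm anti unfolding clifford_generators_def N2 by blast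
qed

lemma ex_clifford_generators: "\<exists>\<Gamma>. clifford_generators n \<Gamma>"
proof (induction n)
  \<comment> \<open>The index set \<open>{1..2 * 0}\<close> is empty, so any family
    qualifies.\<close>
  case 0
  then show ?case by (simp add: clifford_generators_def)
next
  case (Suc n)
  then show ?case using clifford_generators_double by blast
qed

theorem theorem1:
  fixes n :: nat
  assumes "n \<ge> 1"
  shows "\<exists>\<Gamma>. clifford_generators n \<Gamma> \<and>
           (\<exists>i\<in>{1..2 * n}. \<exists>\<psi>. \<psi> \<in> type_I_class (2 ^ n) (2 * n) \<Gamma> i)"
proof -
  \<comment> \<open>Exposing the last doubling makes the generator with index \<open>2 * n\<close>
    explicit: it is \<sigma>_3 \<otimes> I. The others need only the Clifford relations.\<close>
  obtain m where n: "n = Suc m"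
    using assms by (cases n) auto
  obtain \<Gamma>0 where "clifford_generators m \<Gamma>0"
    using ex_clifford_generators by blast
  define \<Gamma> where "\<Gamma> = double_generators m \<Gamma>0"
  have cl: "clifford_generators n \<Gamma>"
    using clifford_generators_double \<open>clifford_generators m \<Gamma>0\<close> by (simp add: \<Gamma>_def n)
  \<comment> \<open>The upper half of \<sigma>_3 \<otimes> I is the identity block followed by the
    zero block, and the lower left block is zero, so its column 0 is the first basis vector
    itself.\<close>
  define v :: "complex vec" where "v = unit_vec (2 ^ n) 0"
  have v: "v \<in> carrier_vec (2 ^ n)" "v \<bullet>c v = 1"
    by (auto simp: v_def)
  have G: "\<Gamma> (2 * n) \<in> carrier_mat (2 ^ n) (2 ^ n)" "mat_adjoint (\<Gamma> (2 * n)) = \<Gamma> (2 * n)"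
    using cl assms by (auto simp: clifford_generators_def)
  have "\<Gamma> (2 * n) *\<^sub>v v = col (\<Gamma> (2 * n)) 0"
    using G by (intro eq_vecI) (auto simp: v_def)
  also have "\<dots> = v"
    by (intro eq_vecI) (auto simp: v_def \<Gamma>_def double_generators_def tensor2_def n)
  finally have fix_v: "\<Gamma> (2 * n) *\<^sub>v v = v" .
  \<comment> \<open>The witnesses are i = \<open>2 * n\<close> and c = 1: at k = i the expectation
    is the squared norm of \<open>v\<close>, and every other generator anticommutes with the one
    fixing \<open>v\<close>.\<close>
  have "expectation (\<Gamma> k) v = (if 2 * n = k then 1 else 0) * 1" if k: "k \<in> {1..2 * n}" for k
  proof (cases "k = 2 * n")
    case True
    then show ?thesis using fix_v v by (simp add: expectation_def)
  next
    case False
    have "\<Gamma> (2 * n) * \<Gamma> k + \<Gamma> k * \<Gamma> (2 * n) = 0 \<cdot>\<^sub>m 1\<^sub>m (2 ^ n)"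
      using cl k assms False by (auto simp: clifford_generators_def)
    also have "\<dots> = 0\<^sub>m (2 ^ n) (2 ^ n)"
      by auto
    finally show ?thesis
      using expectation_anticommuting_eq_0[OF G _ _ v(1) fix_v] cl k False
      by (auto simp: clifford_generators_def)
  qed
  then have "v \<in> type_I_class (2 ^ n) (2 * n) \<Gamma> (2 * n)"
    using v by (auto simp: type_I_class_def states_def intro!: exI[of _ 1])
  then show ?thesis
    using cl assms by force
qed

end
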